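(* Let $A$ be a (left) Leibniz algebra of finite dimension $n$ over a field $F$ having at least $n+1$ elements. Let $U$ be a subalgebra of $A$. Then $U$ is a Cartan subalgebra of $A$ if and only if $U$ is minimal (under inclusion) in the set $\{E_A(a)\mid a\in A\}$ of Engel subalgebras of $A$.
   Context: A (left) Leibniz algebra is a vector space $A$ over $F$ with a bilinear product satisfying $a(bc)=(ab)c+b(ac)$ for all $a,b,c\in A$. For $a\in A$, $L_a\colon A\to A$ is $L_a(x)=ax$, and the Engel subalgebra of $a$ is $E_A(a)=\{x\in A\mid L_a^k(x)=0\text{ for some }k\}$, which is a subalgebra of $A$. A Leibniz algebra $B$ is nilpotent if $B^k=0$ for some $k$, where $B^1=B$, $B^{k+1}=BB^k$. The normaliser of a subalgebra $U$ is $\mathcal{N}_A(U)=\{a\in A\mid au\in U\text{ and }ua\in U\text{ for all }u\in U\}$. A Cartan subalgebra of $A$ is a nilpotent subalgebra $C$ such that $\mathcal{N}_A(C)=C$. *)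

theory Defs
  imports Complex_Main
begin

text \<open>Left Leibniz algebras. The underlying vector space is the whole type \<open>'a\<close>, with an
  arbitrary field \<open>'f\<close> acting through \<open>scale\<close>; \<open>span\<close> and \<open>subspace\<close> below refer to this action.\<close>

locale leibniz_algebra = vector_space scale
  for scale :: "'f::field \<Rightarrow> 'a::ab_group_add \<Rightarrow> 'a" +
  fixes mult :: "'a \<Rightarrow> 'a \<Rightarrow> 'a" (infixl "\<cdot>" 70)
  assumes linear_mult_left: "Vector_Spaces.linear scale scale (\<lambda>x. x \<cdot> b)"
    and linear_mult_right: "Vector_Spaces.linear scale scale (\<lambda>x. a \<cdot> x)"
    and leibniz: "a \<cdot> (b \<cdot> c) = (a \<cdot> b) \<cdot> c + b \<cdot> (a \<cdot> c)"
begin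

definition subalgebra :: "'a set \<Rightarrow> bool" where
  "subalgebra U \<longleftrightarrow> subspace U \<and> (\<forall>u\<in>U. \<forall>v\<in>U. u \<cdot> v \<in> U)"

definition Engel :: "'a \<Rightarrow> 'a set" where
  "Engel a = {x. \<exists>k. ((\<lambda>y. a \<cdot> y) ^^ k) x = 0}"

text \<open>The product of two subspaces is the span of the elementwise products.\<close>

definition set_mult :: "'a set \<Rightarrow> 'a set \<Rightarrow> 'a set" where
  "set_mult U V = span {u \<cdot> v |u v. u \<in> U \<and> v \<in> V}"

text \<open>The index is shifted by one: \<open>lower_central B k\<close> is the power \<open>B\<^sup>k\<^sup>+\<^sup>1\<close>, since the series
  of powers starts with \<open>B\<^sup>1 = B\<close>.\<close>

primrec lower_central :: "'a set \<Rightarrow> nat \<Rightarrow> 'a set" where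
  "lower_central B 0 = B"
| "lower_central B (Suc k) = set_mult B (lower_central B k)"

definition nilpotent :: "'a set \<Rightarrow> bool" where
  "nilpotent B \<longleftrightarrow> (\<exists>k. lower_central B k = {0})"

definition normaliser :: "'a set \<Rightarrow> 'a set" where
  "normaliser U = {a. \<forall>u\<in>U. a \<cdot> u \<in> U \<and> u \<cdot> a \<in> U}"

definition Cartan_subalgebra :: "'a set \<Rightarrow> bool" where
  "Cartan_subalgebra C \<longleftrightarrow> subalgebra C \<and> nilpotent C \<and> normaliser C = C"

end

definition minimal_in :: "'b set \<Rightarrow> 'b set set \<Rightarrow> bool" where
  "minimal_in U S \<longleftrightarrow> U \<in> S \<and> (\<forall>V\<in>S. V \<subseteq> U \<longrightarrow> V = U)"

end

theory Submission
  imports Defs "HOL-Computational_Algebra.Polynomial"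
begin

text \<open>Let \<open>z\<close> and \<open>u\<close> lie in a subspace \<open>P\<close> of \<open>E = Engel z\<close>, with \<open>Engel z\<close> minimal among the
  \<open>Engel w\<close> for \<open>w \<in> P\<close>. For \<open>w = z + t (u - z)\<close>, left multiplication by \<open>w\<close> is singular modulo
  \<open>E\<close> for at most \<open>n - dim E\<close> values of \<open>t\<close>. For each of the other, at least \<open>dim E + 1\<close>, values
  \<open>Engel w \<subseteq> E\<close>, hence \<open>Engel w = E\<close> by minimality, and \<open>w\<close> is nilpotent on \<open>E\<close>. The
  \<open>dim E\<close>-th power of \<open>w\<close> on \<open>E\<close> is a polynomial in \<open>t\<close> of degree at most \<open>dim E\<close>, so it vanishes
  identically; \<open>t = 1\<close> gives \<open>Engel z \<subseteq> Engel u\<close>. For a minimal Engel subalgebra take \<open>P = E\<close>: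
  by Engel's theorem it is nilpotent. For a Cartan subalgebra \<open>U\<close> take \<open>P = U\<close>: then \<open>U\<close> acts
  nilpotently on \<open>E\<close>, and by Engel's theorem \<open>U \<subset> E\<close> would make its normaliser larger.\<close>

section \<open>Nilpotent linear maps and dimension\<close>

context finite_dimensional_vector_space
begin

lemma linear_funpow:
  assumes "Vector_Spaces.linear scale scale f"
  shows "Vector_Spaces.linear scale scale (f ^^ k)"
proof (induction k)
  case 0
  then show ?case
    by (simp add: Vector_Spaces.linear_iff vector_space_axioms vector_space_assms)
next
  case (Suc k)
  then show ?case
    using assms by (simp add: Vector_Spaces.linear_iff)
qed

lemma funpow_in_invariant:
  assumes "\<And>x. x \<in> E \<Longrightarrow> f x \<in> E" and "x \<in> E"
  shows "(f ^^ k) x \<in> E"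
  using assms by (induction k) auto

text \<open>Induction from the tail of the orbit: \<open>f ^^ j\<close> kills the span of the later
  iterates but not \<open>x\<close>, so \<open>x\<close> adds a dimension.\<close>

lemma dim_nilpotent_orbit:
  assumes "Vector_Spaces.linear scale scale f"
    and "(f ^^ Suc j) x = 0" and "(f ^^ j) x \<noteq> 0"
  shows "dim ((\<lambda>i. (f ^^ i) x) ` {..j}) = Suc j"
  using assms(2,3)
proof (induction j arbitrary: x)
  case 0
  then show ?case by simp
next
  case (Suc j)
  let ?S = "(\<lambda>i. (f ^^ i) (f x)) ` {..j}"
  have eq: "(\<lambda>i. (f ^^ i) x) ` {..Suc j} = insert x ?S"
    by (simp add: atMost_Suc_eq_insert_0 image_image funpow_Suc_right del: funpow.simps(2))
  interpret p: Vector_Spaces.linear scale scale "f ^^ Suc j"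
    by (rule linear_funpow[OF assms(1)])
  have zero: "(f ^^ i) 0 = 0" for i
  proof -
    interpret q: Vector_Spaces.linear scale scale "f ^^ i"
      by (rule linear_funpow[OF assms(1)])
    show ?thesis by (rule q.zero)
  qed
  have "?S \<subseteq> {y. (f ^^ Suc j) y = 0}"
  proof clarify
    fix i
    have "(f ^^ Suc j) ((f ^^ i) (f x)) = (f ^^ (Suc j + i + 1)) x"
      by (simp add: funpow_add funpow_swap1)
    also have "\<dots> = (f ^^ (i + Suc (Suc j))) x"
      by (rule arg_cong[where f = "\<lambda>n. (f ^^ n) x"]) simp
    also have "\<dots> = (f ^^ i) 0"
      using Suc.prems(1) by (simp only: funpow_add o_apply)
    finally show "(f ^^ Suc j) ((f ^^ i) (f x)) = 0"
      by (simp add: zero)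
  qed
  then have "span ?S \<subseteq> {y. (f ^^ Suc j) y = 0}"
    by (rule span_minimal) (rule p.subspace_kernel)
  with Suc.prems(2) have "x \<notin> span ?S"
    by blast
  moreover have "dim ?S = Suc j"
    using Suc.prems by (intro Suc.IH) (simp_all add: funpow_swap1)
  ultimately show ?case
    unfolding eq by (simp add: dim_insert)
qed

text \<open>The iterates of \<open>x\<close> before it vanishes are independent inside
  \<open>E\<close>. The resulting exponent does not depend on \<open>f\<close>, so it serves a whole
  pencil at once.\<close>

lemma nilpotent_index_le_dim:
  assumes f: "Vector_Spaces.linear scale scale f"
    and E: "\<And>x. x \<in> E \<Longrightarrow> f x \<in> E"
    and x: "x \<in> E" and "(f ^^ m) x = 0"
  shows "(f ^^ dim E) x = 0"
proof -
  define j where "j = (LEAST m. (f ^^ m) x = 0)"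
  have j: "(f ^^ j) x = 0"
    unfolding j_def using assms(4) by (rule LeastI)
  have "j \<le> dim E"
  proof (cases j)
    case (Suc i)
    have "(f ^^ i) x \<noteq> 0"
      using not_less_Least[of i "\<lambda>m. (f ^^ m) x = 0"] Suc by (simp add: j_def)
    then have "dim ((\<lambda>i. (f ^^ i) x) ` {..i}) = j"
      using dim_nilpotent_orbit[OF f] j Suc by blast
    moreover have "(\<lambda>i. (f ^^ i) x) ` {..i} \<subseteq> E"
      using funpow_in_invariant[of E f x] E x by auto
    ultimately show ?thesis
      using dim_subset by metis
  qed simp
  then obtain d where d: "dim E = d + j"
    using le_iff_add[of j "dim E"] by (auto simp: add.commute)
  interpret q: Vector_Spaces.linear scale scale "f ^^ d"
    by (rule linear_funpow[OF f])
  show ?thesis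
    using j by (simp add: d funpow_add)
qed

text \<open>The images of \<open>K\<close> decrease, so one of least dimension equals the
  next.\<close>

lemma funpow_image_stabilises:
  assumes f: "Vector_Spaces.linear scale scale f"
    and K: "subspace K" "\<And>x. x \<in> K \<Longrightarrow> f x \<in> K"
  shows "\<exists>N. (f ^^ Suc N) ` K = (f ^^ N) ` K"
proof -
  obtain N where N: "\<And>i. dim ((f ^^ N) ` K) \<le> dim ((f ^^ i) ` K)"
    using ex_has_least_nat[of "\<lambda>_. True" 0 "\<lambda>i. dim ((f ^^ i) ` K)"] by auto
  have sub: "subspace ((f ^^ i) ` K)" for i
  proof -
    interpret q: Vector_Spaces.linear scale scale "f ^^ i"
      by (rule linear_funpow[OF f])
    show ?thesis by (rule q.subspace_image[OF K(1)])
  qed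
  have "(f ^^ Suc N) ` K \<subseteq> (f ^^ N) ` K"
    using K(2) by (auto simp: funpow_Suc_right simp del: funpow.simps(2))
  then have "(f ^^ Suc N) ` K = (f ^^ N) ` K"
    using N by (intro subspace_dim_equal sub)
  then show ?thesis ..
qed

section \<open>Vector polynomials and pencils of linear maps\<close>

text \<open>Each coordinate with respect to \<open>Basis\<close> is an ordinary polynomial of degree
  at most \<open>k\<close> with more than \<open>k\<close> roots.\<close>

lemma vector_polynomial_zero:
  fixes T :: "'a set"
  assumes "card T > k" and "\<And>t. t \<in> T \<Longrightarrow> (\<Sum>i\<le>k. t ^ i *s c i) = 0"
  shows "(\<Sum>i\<le>k. t ^ i *s c i) = 0"
proof -
  define r where "r b = (\<Sum>i\<le>k. monom (representation Basis (c i) b) i)" for b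
  have rep: "representation Basis (\<Sum>i\<le>k. t ^ i *s c i) b = poly (r b) t" for t b
    by (simp add: r_def representation_sum representation_scale independent_Basis span_Basis
        poly_sum poly_monom mult.commute)
  have "r b = 0" for b
  proof (rule ccontr)
    assume "r b \<noteq> 0"
    have "T \<subseteq> {t. poly (r b) t = 0}"
      using assms(2) by (auto simp: rep[symmetric] representation_zero)
    then have "card T \<le> card {t. poly (r b) t = 0}"
      by (intro card_mono poly_roots_finite \<open>r b \<noteq> 0\<close>)
    also have "\<dots> \<le> degree (r b)"
      by (rule card_poly_roots_bound[OF \<open>r b \<noteq> 0\<close>])
    also have "\<dots> \<le> k"
      unfolding r_def by (intro degree_sum_le) (auto intro: order_trans[OF degree_monom_le])
    finally show False
      using assms(1) by simp
  qed
  then have "representation Basis (\<Sum>i\<le>k. t ^ i *s c i) = representation Basis 0"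
    using rep[of t] by (simp add: fun_eq_iff representation_zero)
  then have "(\<Sum>b | representation Basis (\<Sum>i\<le>k. t ^ i *s c i) b \<noteq> 0.
      representation Basis (\<Sum>i\<le>k. t ^ i *s c i) b *s b) = 0"
    by (simp add: representation_zero)
  then show ?thesis
    by (subst (asm) sum_nonzero_representation_eq) (simp_all add: independent_Basis span_Basis)
qed

lemma pencil_funpow_polynomial:
  assumes g: "Vector_Spaces.linear scale scale g" and h: "Vector_Spaces.linear scale scale h"
  shows "\<exists>c. \<forall>t. ((\<lambda>y. g y + t *s h y) ^^ k) x = (\<Sum>i\<le>k. t ^ i *s c i)"
proof (induction k)
  case 0
  show ?case by (rule exI[of _ "\<lambda>_. x"]) simp
next
  case (Suc k)
  interpret g: Vector_Spaces.linear scale scale g by fact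
  interpret h: Vector_Spaces.linear scale scale h by fact
  from Suc obtain c where c: "((\<lambda>y. g y + t *s h y) ^^ k) x = (\<Sum>i\<le>k. t ^ i *s c i)" for t
    by blast
  \<comment> \<open>The coefficient of \<open>t ^ i\<close> is
    \<open>g (c i) + h (c (i - 1))\<close>, where \<open>c\<close> counts as 0 outside the indices 0
    to \<open>k\<close>.\<close>
  define d where "d i = (if i \<le> k then g (c i) else 0) + (case i of 0 \<Rightarrow> 0 | Suc j \<Rightarrow> h (c j))" for i
  have "((\<lambda>y. g y + t *s h y) ^^ Suc k) x = (\<Sum>i\<le>Suc k. t ^ i *s d i)" for t
  proof -
    have "(\<Sum>i\<le>Suc k. t ^ i *s d i)
        = (\<Sum>i\<le>Suc k. t ^ i *s (if i \<le> k then g (c i) else 0))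
        + (\<Sum>i\<le>Suc k. t ^ i *s (case i of 0 \<Rightarrow> 0 | Suc j \<Rightarrow> h (c j)))"
      by (simp only: d_def scale_right_distrib sum.distrib)
    also have "(\<Sum>i\<le>Suc k. t ^ i *s (if i \<le> k then g (c i) else 0)) = (\<Sum>i\<le>k. t ^ i *s g (c i))"
      by simp
    also have "(\<Sum>i\<le>Suc k. t ^ i *s (case i of 0 \<Rightarrow> 0 | Suc j \<Rightarrow> h (c j)))
        = (\<Sum>i\<le>k. t ^ Suc i *s h (c i))"
      by (simp only: sum.atMost_Suc_shift) simp
    finally show ?thesis
      by (simp add: c g.sum h.sum g.scale h.scale scale_sum_right)
  qed
  then show ?case by blast
qed

text \<open>If \<open>t\<close> is a parameter at which \<open>g + t h\<close> is singular modulo \<open>E\<close>, witnessed by \<open>v t\<close>, then \<open>v t\<close>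
  is an eigenvector of \<open>g\<^sup>-\<^sup>1 h\<close> modulo \<open>E\<close> for the eigenvalue \<open>-1/t\<close>; so the witnesses for
  distinct parameters are independent modulo \<open>E\<close>.\<close>

lemma singular_witnesses_independent:
  assumes g: "Vector_Spaces.linear scale scale g" and h: "Vector_Spaces.linear scale scale h"
    and E: "subspace E" "\<And>x. x \<in> E \<Longrightarrow> g x \<in> E" "\<And>x. x \<in> E \<Longrightarrow> h x \<in> E"
    and inj: "\<And>y. g y \<in> E \<Longrightarrow> y \<in> E"
    and "finite T"
    and "\<And>t. t \<in> T \<Longrightarrow> v t \<notin> E \<and> g (v t) + t *s h (v t) \<in> E"
    and "(\<Sum>t\<in>T. c t *s v t) \<in> E"
  shows "\<forall>t\<in>T. c t = 0"
  using assms(7-9)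
proof (induction T arbitrary: c rule: finite_induct)
  case empty
  then show ?case by simp
next
  case (insert s T)
  interpret g: Vector_Spaces.linear scale scale g by fact
  interpret h: Vector_Spaces.linear scale scale h by fact
  let ?I = "insert s T"
  \<comment> \<open>At \<open>t = 0\<close> the pencil is \<open>g\<close>, which is injective
    modulo \<open>E\<close>, so 0 has no witness.\<close>
  have nz: "t \<noteq> 0" if "t \<in> ?I" for t
    using insert.prems(1)[OF that] inj by auto
  have hE: "(\<Sum>t\<in>?I. c t *s h (v t)) \<in> E"
    using E(3)[OF insert.prems(2)] by (simp only: h.sum h.scale)
  moreover have "(\<Sum>t\<in>?I. (c t / t) *s (g (v t) + t *s h (v t))) \<in> E"
    using insert.prems(1) by (intro subspace_sum subspace_scale E(1)) auto
  moreover have "(\<Sum>t\<in>?I. (c t / t) *s (g (v t) + t *s h (v t)))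
      = (\<Sum>t\<in>?I. (c t / t) *s g (v t)) + (\<Sum>t\<in>?I. c t *s h (v t))"
    unfolding sum.distrib[symmetric]
    using nz by (intro sum.cong) (auto simp: scale_right_distrib)
  ultimately have "(\<Sum>t\<in>?I. (c t / t) *s g (v t)) + (\<Sum>t\<in>?I. c t *s h (v t)) \<in> E"
    by (simp only:)
  from subspace_diff[OF E(1) this hE] have "(\<Sum>t\<in>?I. (c t / t) *s g (v t)) \<in> E"
    by (simp only: add_diff_cancel_right')
  then have "g (\<Sum>t\<in>?I. (c t / t) *s v t) \<in> E"
    by (simp only: g.sum g.scale)
  then have "(\<Sum>t\<in>?I. (c t / t) *s v t) \<in> E"
    by (rule inj)
  \<comment> \<open>Subtracting \<open>1 / s\<close> times the given relation cancels the term at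
    \<open>s\<close> and leaves a relation over \<open>T\<close>.\<close>
  then have "(\<Sum>t\<in>?I. (c t / t) *s v t) - (1 / s) *s (\<Sum>t\<in>?I. c t *s v t) \<in> E"
    using insert.prems(2) by (intro subspace_diff subspace_scale E(1))
  also have "(\<Sum>t\<in>?I. (c t / t) *s v t) - (1 / s) *s (\<Sum>t\<in>?I. c t *s v t)
      = (\<Sum>t\<in>?I. (c t / t - c t / s) *s v t)"
    by (simp only: scale_sum_right sum_subtractf[symmetric] scale_left_diff_distrib scale_scale) simp
  also have "\<dots> = (\<Sum>t\<in>T. (c t / t - c t / s) *s v t)"
    using insert.hyps by simp
  finally have "\<forall>t\<in>T. c t / t - c t / s = 0"
    using insert.prems(1) by (intro insert.IH) auto
  moreover have "c t / t - c t / s \<noteq> 0" if "t \<in> T" "c t \<noteq> 0" for t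
    using that nz[of t] nz[of s] insert.hyps(2) by (auto simp: field_simps)
  ultimately have T: "\<forall>t\<in>T. c t = 0"
    by blast
  then have "c s *s v s \<in> E"
    using insert.prems(2) insert.hyps by (simp add: sum.neutral)
  then have "c s = 0"
    using subspace_scale[OF E(1), of "c s *s v s" "1 / c s"] insert.prems(1)[of s]
    by (auto split: if_splits)
  with T show ?case by simp
qed

lemma span_Un_image_finite:
  assumes "subspace E" and "finite T" and "x \<in> span (E \<union> v ` T)"
  shows "\<exists>c. x - (\<Sum>t\<in>T. c t *s v t) \<in> E"
  using assms(2,3)
proof (induction T arbitrary: x rule: finite_induct)
  case empty
  then show ?case
    using assms(1) by (simp add: span_eq_iff[THEN iffD2])
next
  case (insert s T)
  then obtain k where "x - k *s v s \<in> span (E \<union> v ` T)"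
    by (auto simp: span_breakdown_eq)
  then obtain c where c: "x - k *s v s - (\<Sum>t\<in>T. c t *s v t) \<in> E"
    using insert.IH by blast
  have "(\<Sum>t\<in>T. (c(s := k)) t *s v t) = (\<Sum>t\<in>T. c t *s v t)"
    using insert.hyps by (intro sum.cong) auto
  then have "x - (\<Sum>t\<in>insert s T. (c(s := k)) t *s v t) \<in> E"
    using c insert.hyps by (simp add: diff_diff_eq)
  then show ?case by blast
qed

text \<open>A witness in the span of \<open>E\<close> and the others would give a relation modulo
  \<open>E\<close> with a coefficient 1. So each singular parameter costs a dimension outside
  \<open>E\<close>, which bounds their number.\<close>

lemma card_singular_parameters:
  assumes g: "Vector_Spaces.linear scale scale g" and h: "Vector_Spaces.linear scale scale h"
    and E: "subspace E" "\<And>x. x \<in> E \<Longrightarrow> g x \<in> E" "\<And>x. x \<in> E \<Longrightarrow> h x \<in> E"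
    and inj: "\<And>y. g y \<in> E \<Longrightarrow> y \<in> E"
    and "finite T"
    and "\<And>t. t \<in> T \<Longrightarrow> v t \<notin> E \<and> g (v t) + t *s h (v t) \<in> E"
  shows "dim (E \<union> v ` T) = dim E + card T"
  using assms(7,8)
proof (induction T rule: finite_induct)
  case empty
  then show ?case by simp
next
  case (insert s T)
  have "v s \<notin> span (E \<union> v ` T)"
  proof
    assume "v s \<in> span (E \<union> v ` T)"
    then obtain c where c: "v s - (\<Sum>t\<in>T. c t *s v t) \<in> E"
      using span_Un_image_finite[OF E(1) insert.hyps(1)] by blast
    have "(\<Sum>t\<in>T. (if t = s then 1 else - c t) *s v t) = (\<Sum>t\<in>T. (- c t) *s v t)"
      using insert.hyps by (intro sum.cong) auto
    then have "(\<Sum>t\<in>insert s T. (if t = s then 1 else - c t) *s v t) \<in> E"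
      using c insert.hyps by (simp add: sum_negf)
    then have "\<forall>t\<in>insert s T. (if t = s then 1 else - c t) = 0"
      using insert.hyps(1) insert.prems
      by (intro singular_witnesses_independent[OF g h E inj, where v = v]) auto
    then show False by auto
  qed
  then show ?case
    using insert by (simp add: dim_insert)
qed

text \<open>Carries nilpotency on \<open>E\<close> from the parameters that are nonsingular modulo
  \<open>E\<close> to every \<open>t\<close>, by counting zeros of a polynomial in \<open>t\<close>;
  here the size of the field enters.\<close>

lemma pencil_nilpotent:
  assumes g: "Vector_Spaces.linear scale scale g" and h: "Vector_Spaces.linear scale scale h"
    and E: "subspace E" "\<And>x. x \<in> E \<Longrightarrow> g x \<in> E" "\<And>x. x \<in> E \<Longrightarrow> h x \<in> E"
    and inj: "\<And>y. g y \<in> E \<Longrightarrow> y \<in> E"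
    and nil: "\<And>t x. (\<And>y. g y + t *s h y \<in> E \<Longrightarrow> y \<in> E) \<Longrightarrow> x \<in> E \<Longrightarrow>
      \<exists>m. ((\<lambda>y. g y + t *s h y) ^^ m) x = 0"
    and F: "infinite (UNIV :: 'a set) \<or> card (UNIV :: 'a set) \<ge> dim UNIV + 1"
    and x: "x \<in> E"
  shows "((\<lambda>y. g y + t *s h y) ^^ dim E) x = 0"
proof -
  interpret g: Vector_Spaces.linear scale scale g by fact
  interpret h: Vector_Spaces.linear scale scale h by fact
  define bad where "bad = {t. \<exists>y. g y + t *s h y \<in> E \<and> y \<notin> E}"
  define v where "v t = (SOME y. g y + t *s h y \<in> E \<and> y \<notin> E)" for t
  have v: "v t \<notin> E \<and> g (v t) + t *s h (v t) \<in> E" if "t \<in> bad" for t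
    using someI_ex[of "\<lambda>y. g y + t *s h y \<in> E \<and> y \<notin> E"] that
    by (simp add: bad_def v_def)
  have bound: "dim E + card T \<le> dim UNIV" if "finite T" "T \<subseteq> bad" for T
  proof -
    have "dim (E \<union> v ` T) = dim E + card T"
      using that v by (intro card_singular_parameters[OF g h E inj]) auto
    then show ?thesis
      by (metis dim_subset subset_UNIV)
  qed
  have fin: "finite bad"
  proof (rule ccontr)
    assume "infinite bad"
    then obtain T where "T \<subseteq> bad" "finite T" "card T = dim UNIV + 1"
      using infinite_arbitrarily_large by metis
    then show False
      using bound[of T] by simp
  qed
  \<comment> \<open>Degree at most \<open>dim E\<close> calls for \<open>dim E + 1\<close> zeros. A
    finite field leaves at least \<open>(dim UNIV + 1) - (dim UNIV - dim E)\<close> good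
    parameters.\<close>
  have "\<exists>T. finite T \<and> card T = dim E + 1 \<and> T \<subseteq> - bad"
  proof (cases "finite (UNIV :: 'a set)")
    case True
    have "card (- bad) = card (UNIV :: 'a set) - card bad"
      by (simp add: Compl_eq_Diff_UNIV card_Diff_subset fin)
    moreover have "dim E + card bad \<le> dim UNIV"
      using bound fin by blast
    ultimately have "dim E + 1 \<le> card (- bad)"
      using F True by linarith
    then show ?thesis
      by (metis obtain_subset_with_card_n finite_subset[OF subset_UNIV True])
  next
    case False
    then have "infinite (- bad)"
      using fin by (metis Compl_partition finite_Un Un_commute)
    then show ?thesis
      using infinite_arbitrarily_large by metis
  qed
  then obtain T where T: "card T = dim E + 1" "T \<subseteq> - bad"
    by blast
  obtain c where c: "((\<lambda>y. g y + t *s h y) ^^ dim E) x = (\<Sum>i\<le>dim E. t ^ i *s c i)" for t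
    using pencil_funpow_polynomial[OF g h] by blast
  have "(\<Sum>i\<le>dim E. t ^ i *s c i) = 0" if "t \<in> T" for t
  proof -
    have "\<And>y. g y + t *s h y \<in> E \<Longrightarrow> y \<in> E"
      using that T(2) by (auto simp: bad_def)
    then obtain m where "((\<lambda>y. g y + t *s h y) ^^ m) x = 0"
      using nil x by blast
    moreover have "Vector_Spaces.linear scale scale (\<lambda>y. g y + t *s h y)"
      by (simp add: Vector_Spaces.linear_iff vector_space_axioms g.add h.add g.scale h.scale
          scale_right_distrib mult.commute)
    ultimately have "((\<lambda>y. g y + t *s h y) ^^ dim E) x = 0"
      using E x by (intro nilpotent_index_le_dim[where m = m]) (auto intro: subspace_add subspace_scale)
    then show ?thesis
      by (simp only: c)
  qed
  with T(1) have "(\<Sum>i\<le>dim E. t ^ i *s c i) = 0" for t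
    using vector_polynomial_zero[of "dim E" T c t] by simp
  then show ?thesis
    by (simp only: c)
qed

end

section \<open>Leibniz algebras and the left kernel\<close>

locale fin_dim_leibniz_algebra =
  leibniz_algebra scale mult + finite_dimensional_vector_space scale Basis
  for scale :: "'f::field \<Rightarrow> 'a::ab_group_add \<Rightarrow> 'a"
    and mult :: "'a \<Rightarrow> 'a \<Rightarrow> 'a" (infixl "\<cdot>" 70)
    and Basis :: "'a set"
begin

lemma mult_add_left: "(x + y) \<cdot> b = x \<cdot> b + y \<cdot> b"
  and mult_scale_left: "scale c x \<cdot> b = scale c (x \<cdot> b)"
  using linear_mult_left[of b] by (simp_all add: Vector_Spaces.linear_iff)

lemma mult_add_right: "a \<cdot> (x + y) = a \<cdot> x + a \<cdot> y"
  and mult_scale_right: "a \<cdot> scale c x = scale c (a \<cdot> x)"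
  using linear_mult_right[of a] by (simp_all add: Vector_Spaces.linear_iff)

lemma mult_zero_left [simp]: "0 \<cdot> b = 0"
  using mult_add_left[of 0 0 b] by simp

lemma mult_zero_right [simp]: "a \<cdot> 0 = 0"
  using mult_add_right[of a 0 0] by simp

lemma mult_diff_left: "(x - y) \<cdot> b = x \<cdot> b - y \<cdot> b"
  using mult_add_left[of "x - y" y b] by simp

lemma mult_diff_right: "a \<cdot> (x - y) = a \<cdot> x - a \<cdot> y"
  using mult_add_right[of a "x - y" y] by simp

lemma linear_mult_funpow: "Vector_Spaces.linear scale scale ((\<cdot>) a ^^ k)"
  by (rule linear_funpow) (rule linear_mult_right)

lemma funpow_mult_zero [simp]: "((\<cdot>) a ^^ k) 0 = 0"
  by (induction k) auto

lemma funpow_zero_mono: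
  assumes "((\<cdot>) a ^^ k) x = 0" and "k \<le> m"
  shows "((\<cdot>) a ^^ m) x = 0"
proof -
  have "((\<cdot>) a ^^ (m - k + k)) x = 0"
    using assms(1) by (simp only: funpow_add o_apply funpow_mult_zero)
  then show ?thesis
    using assms(2) by simp
qed

text \<open>The kernel of the map from elements to left multiplications. It is a two-sided ideal
  containing all squares, so the quotient by it is a Lie algebra.\<close>

definition left_kernel :: "'a set" where
  "left_kernel = {k. \<forall>x. k \<cdot> x = 0}"

lemma left_kernelD: "k \<in> left_kernel \<Longrightarrow> k \<cdot> x = 0"
  by (simp add: left_kernel_def)

lemma subspace_left_kernel: "subspace left_kernel"
  by (rule subspaceI) (simp_all add: left_kernel_def mult_add_left mult_scale_left)

text \<open>Add the Leibniz identities for \<open>a \<cdot> (b \<cdot> c)\<close> and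
  \<open>b \<cdot> (a \<cdot> c)\<close>.\<close>

lemma symmetrised_mult_in_left_kernel: "a \<cdot> b + b \<cdot> a \<in> left_kernel"
  using leibniz[of a b] leibniz[of b a] by (simp add: left_kernel_def mult_add_left)

text \<open>Taken directly from the Leibniz identity, since halving the symmetrised product fails in
  characteristic 2.\<close>

lemma square_in_left_kernel: "a \<cdot> a \<in> left_kernel"
  using leibniz[of a a] by (simp add: left_kernel_def)

lemma mult_left_kernel: "k \<in> left_kernel \<Longrightarrow> x \<cdot> k \<in> left_kernel"
  using leibniz[of x k] by (simp add: left_kernel_def)

section \<open>Engel subalgebras\<close>

lemma EngelI: "((\<cdot>) a ^^ k) x = 0 \<Longrightarrow> x \<in> Engel a"
  unfolding Engel_def by blast

lemma EngelE:
  assumes "x \<in> Engel a"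
  obtains k where "((\<cdot>) a ^^ k) x = 0"
  using assms unfolding Engel_def by blast

text \<open>From left to right, \<open>a\<close> acts injectively modulo \<open>Engel a\<close>.
  This makes the pencil nonsingular at \<open>t = 0\<close> and yields self-normalisation.\<close>

lemma mult_in_Engel_iff: "a \<cdot> x \<in> Engel a \<longleftrightarrow> x \<in> Engel a"
proof
  assume "a \<cdot> x \<in> Engel a"
  then obtain k where "((\<cdot>) a ^^ k) (a \<cdot> x) = 0"
    by (rule EngelE)
  then show "x \<in> Engel a"
    by (intro EngelI[where k = "Suc k"]) (simp add: funpow_swap1)
next
  assume "x \<in> Engel a"
  then obtain k where "((\<cdot>) a ^^ k) x = 0"
    by (rule EngelE)
  then show "a \<cdot> x \<in> Engel a"
    by (intro EngelI[where k = k]) (simp add: funpow_swap1[symmetric])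
qed

lemma subspace_Engel: "subspace (Engel a)"
proof (rule subspaceI)
  show "0 \<in> Engel a"
    by (rule EngelI[where k = 0]) simp
next
  fix x y assume "x \<in> Engel a" "y \<in> Engel a"
  then obtain k m where "((\<cdot>) a ^^ k) x = 0" "((\<cdot>) a ^^ m) y = 0"
    by (metis EngelE)
  then have "((\<cdot>) a ^^ (k + m)) x = 0" "((\<cdot>) a ^^ (k + m)) y = 0"
    by (auto intro: funpow_zero_mono)
  then show "x + y \<in> Engel a"
    using linear_mult_funpow[where k = "k + m"]
    by (intro EngelI[where k = "k + m"]) (simp add: Vector_Spaces.linear_iff)
next
  fix c x assume "x \<in> Engel a"
  then obtain k where "((\<cdot>) a ^^ k) x = 0"
    by (rule EngelE)
  then show "scale c x \<in> Engel a"
    using linear_mult_funpow[where k = k]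
    by (intro EngelI[where k = k]) (simp add: Vector_Spaces.linear_iff)
qed

text \<open>Left multiplication by \<open>a\<close> is a derivation, so
  \<open>a \<cdot> (x \<cdot> y)\<close> splits into two products, each with one exponent lowered;
  induct on \<open>k + m\<close>.\<close>

lemma mult_in_Engel:
  assumes "((\<cdot>) a ^^ k) x = 0" and "((\<cdot>) a ^^ m) y = 0"
  shows "x \<cdot> y \<in> Engel a"
  using assms
proof (induction "k + m" arbitrary: k m x y)
  case 0
  then show ?case
    by (simp add: subspace_0[OF subspace_Engel])
next
  case (Suc n)
  show ?case
  proof (cases "k = 0 \<or> m = 0")
    case True
    then show ?thesis
      using Suc.prems by (auto simp: subspace_0[OF subspace_Engel])
  next
    case False
    then obtain k' m' where km: "k = Suc k'" "m = Suc m'"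
      by (auto simp: gr0_conv_Suc)
    have "(a \<cdot> x) \<cdot> y \<in> Engel a"
      using Suc.prems Suc.hyps(2) km by (intro Suc.hyps(1)[of k' m]) (simp_all add: funpow_swap1)
    moreover have "x \<cdot> (a \<cdot> y) \<in> Engel a"
      using Suc.prems Suc.hyps(2) km by (intro Suc.hyps(1)[of k m']) (simp_all add: funpow_swap1)
    ultimately have "a \<cdot> (x \<cdot> y) \<in> Engel a"
      using leibniz[of a x y] subspace_add[OF subspace_Engel] by metis
    then show ?thesis
      by (simp add: mult_in_Engel_iff)
  qed
qed

lemma subalgebra_Engel: "subalgebra (Engel a)"
  unfolding subalgebra_def by (metis subspace_Engel mult_in_Engel EngelE)

lemma subalgebra_subspace: "subalgebra U \<Longrightarrow> subspace U"
  and subalgebra_mult: "subalgebra U \<Longrightarrow> u \<in> U \<Longrightarrow> v \<in> U \<Longrightarrow> u \<cdot> v \<in> U"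
  by (auto simp: subalgebra_def)

text \<open>In a Leibniz algebra \<open>a\<close> need not lie in \<open>Engel a\<close>. The powers \<open>a (a ( \<dots> a))\<close> do lie in the left
  kernel, where the images of the iterates of \<open>a\<close> stabilise, so \<open>a\<close> can be corrected by an element
  acting trivially.\<close>

lemma Engel_representative:
  obtains b where "b \<in> Engel a" and "Engel b = Engel a"
proof -
  obtain N where N: "((\<cdot>) a ^^ Suc N) ` left_kernel = ((\<cdot>) a ^^ N) ` left_kernel"
    using funpow_image_stabilises[OF linear_mult_right[of a] subspace_left_kernel] mult_left_kernel
    by blast
  have "((\<cdot>) a ^^ Suc N) a = ((\<cdot>) a ^^ N) (a \<cdot> a)"
    by (simp add: funpow_swap1)
  \<comment> \<open>By the choice of \<open>N\<close>, the image of the left kernel element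
    \<open>a \<cdot> a\<close> under the \<open>N\<close>-th power is also an image under the next
    power.\<close>
  then obtain c where c: "c \<in> left_kernel" "((\<cdot>) a ^^ Suc N) a = ((\<cdot>) a ^^ Suc N) c"
    using N square_in_left_kernel[of a] by (metis imageE imageI)
  have eq: "(\<cdot>) (a - c) = (\<cdot>) a"
    using c(1) by (simp add: fun_eq_iff mult_diff_left left_kernelD)
  interpret p: Vector_Spaces.linear scale scale "(\<cdot>) a ^^ Suc N"
    by (rule linear_mult_funpow)
  have "((\<cdot>) a ^^ Suc N) (a - c) = 0"
    using c(2) by (simp only: p.diff diff_self)
  then have "a - c \<in> Engel a"
    by (rule EngelI)
  moreover have "Engel (a - c) = Engel a"
    by (simp only: Engel_def eq)
  ultimately show ?thesis
    by (rule that)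
qed

section \<open>Engel's theorem and nilpotency\<close>

lemma funpow_last_outside:
  assumes "x \<notin> W" and "(f ^^ k) x \<in> W"
  shows "\<exists>j. (f ^^ j) x \<notin> W \<and> f ((f ^^ j) x) \<in> W"
  using assms by (induction k) auto

text \<open>Engel's theorem for a subalgebra \<open>T\<close> acting on \<open>V / W\<close>. Keeping \<open>left_kernel \<inter> U\<close> inside \<open>T\<close>
  makes a left normaliser of a maximal proper subalgebra two-sided, as \<open>s x + x s\<close> lies in the left
  kernel.\<close>

lemma Engel_common_annihilator_aux:
  assumes U: "subalgebra U" "\<And>u. u \<in> U \<Longrightarrow> U \<subseteq> Engel u"
    and "subalgebra T" "T \<subseteq> U" "left_kernel \<inter> U \<subseteq> T"
    and "subspace V" "subspace W" "W \<subset> V"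
    and "\<And>u v. u \<in> T \<Longrightarrow> v \<in> V \<Longrightarrow> u \<cdot> v \<in> V"
    and "\<And>u w. u \<in> T \<Longrightarrow> w \<in> W \<Longrightarrow> u \<cdot> w \<in> W"
    and "\<And>u. u \<in> T \<Longrightarrow> V \<subseteq> Engel u"
  shows "\<exists>x\<in>V - W. \<forall>u\<in>T. u \<cdot> x \<in> W"
  using assms(3-)
proof (induction "dim T" arbitrary: T V W rule: less_induct)
  case less
  note T = less.prems(1-3)
  show ?case
  proof (cases "T = left_kernel \<inter> U")
    \<comment> \<open>Here \<open>T\<close> acts as zero, so any vector of \<open>V\<close> outside
      \<open>W\<close> will do.\<close>
    case True
    then show ?thesis
      using less.prems(5,6) by (auto simp: left_kernelD subspace_0)
  next
    case False
    \<comment> \<open>A subalgebra of this kind of largest dimension will turn out to have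
      codimension 1 in \<open>T\<close>.\<close>
    let ?P = "\<lambda>S. subalgebra S \<and> left_kernel \<inter> U \<subseteq> S \<and> S \<subset> T"
    have "subalgebra (left_kernel \<inter> U)"
      using subalgebra_subspace[OF U(1)] subspace_inter[OF subspace_left_kernel]
      by (auto simp: subalgebra_def mult_left_kernel left_kernelD subspace_0 subspace_left_kernel)
    then have "?P (left_kernel \<inter> U)"
      using False T(3) by blast
    moreover have "\<forall>S. ?P S \<longrightarrow> dim S < Suc (dim T)"
      by (auto intro!: le_imp_less_Suc dim_subset)
    ultimately have "\<exists>S. ?P S \<and> (\<forall>S'. ?P S' \<longrightarrow> dim S' \<le> dim S)"
      by (rule ex_has_greatest_nat)
    then obtain S where S: "?P S" and max: "\<And>S'. ?P S' \<Longrightarrow> dim S' \<le> dim S"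
      by (elim exE conjE) simp
    note subS = subalgebra_subspace[of S] and subT = subalgebra_subspace[OF T(1)]
    have "dim S < dim T"
      using S subS subT by (metis dim_psubset span_eq_iff)
    note IH = less.hyps[OF this, of _ _, OF S[THEN conjunct1]]
    have "S \<subseteq> U" "left_kernel \<inter> U \<subseteq> S"
      using S T(2) by auto
    note IH = IH[OF this]
    \<comment> \<open>The induction hypothesis is applied to \<open>S\<close> acting on
      \<open>T\<close> modulo \<open>S\<close>.\<close>
    have "\<exists>x\<in>T - S. \<forall>s\<in>S. s \<cdot> x \<in> S"
    proof (rule IH)
      show "subspace T" "subspace S" "S \<subset> T"
        using S subS subT by auto
      show "u \<cdot> v \<in> T" if "u \<in> S" "v \<in> T" for u v
        using that S by (intro subalgebra_mult[OF T(1)]) auto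
      show "u \<cdot> w \<in> S" if "u \<in> S" "w \<in> S" for u w
        using that S by (auto intro: subalgebra_mult)
      show "T \<subseteq> Engel u" if "u \<in> S" for u
        using that S T(2) U(2)[of u] by blast
    qed
    then obtain x where x: "x \<in> T" "x \<notin> S" "\<And>s. s \<in> S \<Longrightarrow> s \<cdot> x \<in> S"
      by blast
    have xs: "x \<cdot> s \<in> S" if "s \<in> S" for s
    proof -
      have "x \<cdot> s + s \<cdot> x \<in> U"
        using that x(1) S T(2) U(1)
        by (intro subspace_add subalgebra_mult subalgebra_subspace) auto
      then have "x \<cdot> s + s \<cdot> x \<in> S"
        using symmetrised_mult_in_left_kernel S by blast
      then have "x \<cdot> s + s \<cdot> x - s \<cdot> x \<in> S"
        using x(3)[OF that] subS S by (intro subspace_diff) auto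
      then show ?thesis by simp
    qed
    have xx: "x \<cdot> x \<in> S"
      using square_in_left_kernel[of x] subalgebra_mult[OF U(1), of x x] x(1) T(2) S by blast
    \<comment> \<open>This is a subalgebra larger than \<open>S\<close>, so maximality forces it to
      be \<open>T\<close>.\<close>
    let ?S' = "span (insert x S)"
    have S': "y \<in> ?S' \<longleftrightarrow> (\<exists>c s. s \<in> S \<and> y = s + scale c x)" for y
    proof -
      have "span S = S"
        using S subS by (simp add: span_eq_iff)
      then show ?thesis
        unfolding span_breakdown_eq by (metis add_diff_cancel_right' diff_add_cancel)
    qed
    have S'T: "?S' \<subseteq> T"
      using x(1) S subT by (intro span_minimal) auto
    have "subalgebra ?S'"
      unfolding subalgebra_def
    proof (intro conjI ballI subspace_span)
      fix u v assume "u \<in> ?S'" "v \<in> ?S'"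
      then obtain c s d r where *: "s \<in> S" "u = s + scale c x" "r \<in> S" "v = r + scale d x"
        by (auto simp: S')
      have "u \<cdot> v = s \<cdot> r + scale d (s \<cdot> x) + (scale c (x \<cdot> r) + scale c (scale d (x \<cdot> x)))"
        by (simp add: * mult_add_left mult_add_right mult_scale_left mult_scale_right
            scale_right_distrib mult.commute add.assoc)
      also have "\<dots> \<in> S"
        using *(1,3) x(3)[of s] xs[of r] xx subalgebra_mult[of S s r] S subS
        by (intro subspace_add subspace_scale) blast+
      finally show "u \<cdot> v \<in> ?S'"
        by (simp add: span_base)
    qed
    moreover have "dim ?S' = Suc (dim S)"
      using x(2) S subS by (simp add: dim_insert span_eq_iff[THEN iffD2])
    moreover have "S \<subseteq> ?S'"
      by (auto intro: span_base)
    ultimately have T_eq: "T = ?S'"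
      using max[of ?S'] S S'T by auto
    \<comment> \<open>The induction hypothesis for \<open>S\<close> on \<open>V\<close> modulo
      \<open>W\<close> puts a vector outside \<open>W\<close> into \<open>V0\<close>. As
      \<open>x\<close> preserves \<open>V0\<close> and acts nilpotently, some iterate outside
      \<open>W\<close> is sent into \<open>W\<close> by \<open>x\<close> as well.\<close>
    define V0 where "V0 = {v \<in> V. \<forall>s\<in>S. s \<cdot> v \<in> W}"
    have "\<exists>v\<in>V - W. \<forall>s\<in>S. s \<cdot> v \<in> W"
      using S by (intro IH less.prems) auto
    then obtain v where v: "v \<in> V0" "v \<notin> W"
      by (auto simp: V0_def)
    have inv: "x \<cdot> w \<in> V0" if "w \<in> V0" for w
    proof -
      have "s \<cdot> (x \<cdot> w) \<in> W" if "s \<in> S" for s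
      proof -
        have "(s \<cdot> x) \<cdot> w \<in> W" "x \<cdot> (s \<cdot> w) \<in> W"
          using \<open>w \<in> V0\<close> x that less.prems(8) by (auto simp: V0_def)
        then show ?thesis
          using leibniz[of s x w] subspace_add[OF less.prems(5)] by metis
      qed
      then show ?thesis
        using that less.prems(7) x(1) by (auto simp: V0_def)
    qed
    have "v \<in> Engel x"
      using v less.prems(9)[OF x(1)] by (auto simp: V0_def)
    then obtain k where "((\<cdot>) x ^^ k) v = 0"
      by (rule EngelE)
    then have "((\<cdot>) x ^^ k) v \<in> W"
      using less.prems(5) by (simp add: subspace_0)
    then obtain j where j: "((\<cdot>) x ^^ j) v \<notin> W" "x \<cdot> ((\<cdot>) x ^^ j) v \<in> W"
      using funpow_last_outside v(2) by metis
    let ?y = "((\<cdot>) x ^^ j) v"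
    have y: "?y \<in> V0"
      using inv v(1) by (rule funpow_in_invariant)
    have "u \<cdot> ?y \<in> W" if u: "u \<in> T" for u
    proof -
      obtain c s where "s \<in> S" "u = s + scale c x"
        using u S' unfolding T_eq by blast
      then show ?thesis
        using y j(2) less.prems(5)
        by (auto simp: mult_add_left mult_scale_left V0_def intro!: subspace_add subspace_scale)
    qed
    then show ?thesis
      using j(1) y by (auto simp: V0_def)
  qed
qed

lemma Engel_common_annihilator:
  assumes "subalgebra U" "\<And>u. u \<in> U \<Longrightarrow> U \<subseteq> Engel u"
    and "subspace V" "subspace W" "W \<subset> V"
    and "\<And>u v. u \<in> U \<Longrightarrow> v \<in> V \<Longrightarrow> u \<cdot> v \<in> V"
    and "\<And>u w. u \<in> U \<Longrightarrow> w \<in> W \<Longrightarrow> u \<cdot> w \<in> W"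
    and "\<And>u. u \<in> U \<Longrightarrow> V \<subseteq> Engel u"
  shows "\<exists>x\<in>V - W. \<forall>u\<in>U. u \<cdot> x \<in> W"
  by (rule Engel_common_annihilator_aux[OF assms(1,2,1) order_refl Int_lower2 assms(3-)])

lemma nilpotent_subset_Engel:
  assumes "nilpotent U" and "u \<in> U"
  shows "U \<subseteq> Engel u"
proof
  fix v assume "v \<in> U"
  obtain k where k: "lower_central U k = {0}"
    using assms(1) unfolding nilpotent_def by blast
  have "((\<cdot>) u ^^ i) v \<in> lower_central U i" for i
    using \<open>v \<in> U\<close> assms(2) by (induction i) (auto simp: set_mult_def intro!: span_base)
  from this[of k] show "v \<in> Engel u"
    unfolding k by (intro EngelI[where k = k]) simp
qed

text \<open>Take \<open>W\<close> of largest dimension among the invariant subspaces for which a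
  lower central term inside \<open>W\<close> forces nilpotency. If \<open>W\<close> were proper, a
  common annihilator modulo \<open>W\<close> would enlarge it.\<close>

lemma nilpotent_if_subset_Engel:
  assumes U: "subalgebra U" "\<And>u. u \<in> U \<Longrightarrow> U \<subseteq> Engel u"
  shows "nilpotent U"
proof -
  let ?Q = "\<lambda>W. subspace W \<and> W \<subseteq> U \<and> (\<forall>u\<in>U. \<forall>w\<in>W. u \<cdot> w \<in> W) \<and>
    (\<forall>k. lower_central U k \<subseteq> W \<longrightarrow> nilpotent U)"
  have zero: "0 \<in> lower_central U k" for k
    by (cases k) (auto simp: set_mult_def span_zero subspace_0 subalgebra_subspace U(1))
  have "?Q {0}"
    using zero U(1) unfolding nilpotent_def by (auto simp: subspace_0 subalgebra_subspace)
  moreover have "\<forall>W. ?Q W \<longrightarrow> dim W < Suc (dim U)"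
    by (auto intro!: le_imp_less_Suc dim_subset)
  ultimately have "\<exists>W. ?Q W \<and> (\<forall>W'. ?Q W' \<longrightarrow> dim W' \<le> dim W)"
    by (rule ex_has_greatest_nat)
  then obtain W where W: "?Q W" and max: "\<And>W'. ?Q W' \<Longrightarrow> dim W' \<le> dim W"
    by (elim exE conjE) simp
  have "W = U"
  proof (rule ccontr)
    assume "W \<noteq> U"
    then have "W \<subset> U"
      using W by blast
    moreover have "u \<cdot> w \<in> W" if "u \<in> U" "w \<in> W" for u w
      using W that by blast
    ultimately have "\<exists>x\<in>U - W. \<forall>u\<in>U. u \<cdot> x \<in> W"
      using W subalgebra_subspace[OF U(1)] subalgebra_mult[OF U(1)]
      by (intro Engel_common_annihilator[OF U _ _ _ _ _ U(2)]) blast+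
    then obtain x where x: "x \<in> U" "x \<notin> W" "\<And>u. u \<in> U \<Longrightarrow> u \<cdot> x \<in> W"
      by blast
    let ?W' = "span (insert x W)"
    have spanW: "span W = W"
      using W by (simp add: span_eq_iff)
    \<comment> \<open>A lower central term inside \<open>?W'\<close> is therefore followed by one
      inside \<open>W\<close>.\<close>
    have down: "u \<cdot> y \<in> W" if "u \<in> U" "y \<in> ?W'" for u y
    proof -
      obtain c where c: "y - scale c x \<in> W"
        using \<open>y \<in> ?W'\<close> unfolding span_breakdown_eq spanW by blast
      have "u \<cdot> y = u \<cdot> (y - scale c x) + scale c (u \<cdot> x)"
        by (simp add: mult_diff_right mult_scale_right)
      also have "\<dots> \<in> W"
        using W c x(3) \<open>u \<in> U\<close> by (intro subspace_add subspace_scale) auto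
      finally show ?thesis .
    qed
    have "nilpotent U" if "lower_central U k \<subseteq> ?W'" for k
    proof -
      have "lower_central U (Suc k) \<subseteq> W"
        unfolding lower_central.simps set_mult_def
        using that down W by (intro span_minimal) auto
      then show ?thesis
        using W by blast
    qed
    moreover have "?W' \<subseteq> U"
      using x(1) W subalgebra_subspace[OF U(1)] by (intro span_minimal) auto
    moreover have "u \<cdot> w \<in> ?W'" if "u \<in> U" "w \<in> ?W'" for u w
      using down[OF that] by (simp add: span_base)
    ultimately have "dim ?W' \<le> dim W"
      by (intro max) auto
    then show False
      using x(2) by (simp add: dim_insert spanW)
  qed
  then have "lower_central U 0 \<subseteq> W"
    by simp
  then show ?thesis
    using W by blast
qed

section \<open>Minimal Engel subalgebras and Cartan subalgebras\<close>

text \<open>The pencil of left multiplications by \<open>z\<close> and \<open>u - z\<close> is left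
  multiplication by \<open>u\<close> at \<open>t = 1\<close>. Its parameters stay in the subspace
  \<open>P\<close>, so minimality within \<open>P\<close> suffices.\<close>

lemma minimal_Engel_subset:
  assumes F: "infinite (UNIV :: 'f set) \<or> card (UNIV :: 'f set) \<ge> dim UNIV + 1"
    and P: "subspace P" "P \<subseteq> Engel z" "z \<in> P" "u \<in> P"
    and min: "\<And>w. w \<in> P \<Longrightarrow> Engel w \<subseteq> Engel z \<Longrightarrow> Engel w = Engel z"
  shows "Engel z \<subseteq> Engel u"
proof
  fix x assume x: "x \<in> Engel z"
  let ?E = "Engel z"
  have pencil: "z \<cdot> y + scale t ((u - z) \<cdot> y) = (z + scale t (u - z)) \<cdot> y" for t y
    by (simp add: mult_add_left mult_scale_left)
  have "((\<lambda>y. z \<cdot> y + scale 1 ((u - z) \<cdot> y)) ^^ dim ?E) x = 0"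
  proof (rule pencil_nilpotent[OF linear_mult_right linear_mult_right subspace_Engel _ _ _ _ F x])
    show "z \<cdot> y \<in> ?E" if "y \<in> ?E" for y
      using that by (simp add: mult_in_Engel_iff)
    show "(u - z) \<cdot> y \<in> ?E" if "y \<in> ?E" for y
      using that P subspace_diff[OF P(1)] subalgebra_Engel by (intro subalgebra_mult) auto
    show "y \<in> ?E" if "z \<cdot> y \<in> ?E" for y
      using that by (simp add: mult_in_Engel_iff)
  next
    fix t x'
    assume nonsing: "\<And>y. z \<cdot> y + scale t ((u - z) \<cdot> y) \<in> ?E \<Longrightarrow> y \<in> ?E" and x': "x' \<in> ?E"
    let ?w = "z + scale t (u - z)"
    \<comment> \<open>\<open>?w\<close> is injective modulo \<open>?E\<close>, so an orbit that
      starts outside \<open>?E\<close> never reaches 0.\<close>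
    have "y \<in> ?E" if "y \<in> Engel ?w" for y
    proof (rule ccontr)
      assume "y \<notin> ?E"
      from that obtain k where "((\<cdot>) ?w ^^ k) y = 0"
        by (rule EngelE)
      then have "((\<cdot>) ?w ^^ k) y \<in> ?E"
        by (simp add: subspace_0 subspace_Engel)
      then show False
        using funpow_last_outside[OF \<open>y \<notin> ?E\<close>] nonsing unfolding pencil by blast
    qed
    moreover have "?w \<in> P"
      using P by (intro subspace_add subspace_scale subspace_diff)
    ultimately have "x' \<in> Engel ?w"
      using min x' by blast
    then show "\<exists>m. ((\<lambda>y. z \<cdot> y + scale t ((u - z) \<cdot> y)) ^^ m) x' = 0"
      unfolding pencil by (rule EngelE) blast
  qed
  then show "x \<in> Engel u"
    unfolding pencil by (intro EngelI) simp
qed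

lemma minimal_Engel_imp_Cartan:
  assumes F: "infinite (UNIV :: 'f set) \<or> card (UNIV :: 'f set) \<ge> dim UNIV + 1"
    and "minimal_in U {Engel a |a. True}"
  shows "Cartan_subalgebra U"
proof -
  from assms(2) obtain a where "U = Engel a"
    by (auto simp: minimal_in_def)
  then obtain z where z: "z \<in> U" "U = Engel z"
    using Engel_representative[of a] by metis
  have min: "Engel w = Engel z" if "Engel w \<subseteq> Engel z" for w
    using assms(2) that unfolding minimal_in_def z(2) by blast
  have "U \<subseteq> Engel u" if "u \<in> U" for u
    using minimal_Engel_subset[OF F subspace_Engel order_refl] that z min by blast
  then have "nilpotent U"
    using subalgebra_Engel z(2) by (intro nilpotent_if_subset_Engel) auto
  moreover have "normaliser U = U"
  proof
    \<comment> \<open>As \<open>z\<close> lies in \<open>U\<close>, it multiplies a normalising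
      element into \<open>Engel z\<close>, which then contains that element.\<close>
    show "normaliser U \<subseteq> U"
      using z mult_in_Engel_iff by (auto simp: normaliser_def)
    show "U \<subseteq> normaliser U"
      using subalgebra_Engel z(2) by (auto simp: normaliser_def intro: subalgebra_mult)
  qed
  ultimately show ?thesis
    using subalgebra_Engel z(2) by (simp add: Cartan_subalgebra_def)
qed

text \<open>Engel's theorem controls only \<open>u \<cdot> x\<close>. If \<open>U\<close> contains
  the left kernel part of \<open>V\<close>, then \<open>x \<cdot> u\<close> follows from the
  symmetrised product; otherwise \<open>x\<close> is sought inside the left kernel, where
  \<open>x \<cdot> u = 0\<close>.\<close>

lemma normaliser_grows:
  assumes U: "subalgebra U" "\<And>u. u \<in> U \<Longrightarrow> U \<subseteq> Engel u"
    and V: "subalgebra V" "U \<subset> V" "\<And>u. u \<in> U \<Longrightarrow> V \<subseteq> Engel u"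
  shows "normaliser U \<noteq> U"
proof (cases "left_kernel \<inter> V \<subseteq> U")
  case True
  have "\<exists>x\<in>V - U. \<forall>u\<in>U. u \<cdot> x \<in> U"
  proof (rule Engel_common_annihilator[where U = U and V = V and W = U])
    show "subalgebra U" "U \<subset> V"
      by (rule U V)+
    show "subspace V" "subspace U"
      by (rule subalgebra_subspace U V)+
    show "U \<subseteq> Engel u" "V \<subseteq> Engel u" if "u \<in> U" for u
      using that by (rule U V)+
    show "u \<cdot> v \<in> V" if "u \<in> U" "v \<in> V" for u v
      using that V(2) by (intro subalgebra_mult[OF V(1)]) auto
    show "u \<cdot> v \<in> U" if "u \<in> U" "v \<in> U" for u v
      using that by (rule subalgebra_mult[OF U(1)])
  qed
  then obtain x where x: "x \<in> V" "x \<notin> U" "\<And>u. u \<in> U \<Longrightarrow> u \<cdot> x \<in> U"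
    by blast
  have "x \<cdot> u \<in> U" if "u \<in> U" for u
  proof -
    have "x \<cdot> u + u \<cdot> x \<in> V"
      using that x(1) V(2) subalgebra_subspace[OF V(1)]
      by (intro subspace_add subalgebra_mult[OF V(1)]) blast+
    then have "x \<cdot> u + u \<cdot> x \<in> U"
      using True symmetrised_mult_in_left_kernel by blast
    then have "x \<cdot> u + u \<cdot> x - u \<cdot> x \<in> U"
      using x(3)[OF that] by (intro subspace_diff subalgebra_subspace U(1))
    then show ?thesis by simp
  qed
  then have "x \<in> normaliser U"
    using x(3) by (simp add: normaliser_def)
  with x(2) show ?thesis by blast
next
  case False
  let ?K = "left_kernel \<inter> V"
  have K: "subspace ?K"
    by (intro subspace_inter subspace_left_kernel subalgebra_subspace V(1))
  have KV: "u \<cdot> k \<in> ?K" if "u \<in> U" "k \<in> ?K" for u k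
    using that V(2) mult_left_kernel subalgebra_mult[OF V(1), of u k] by blast
  have "\<exists>x\<in>?K - ?K \<inter> U. \<forall>u\<in>U. u \<cdot> x \<in> ?K \<inter> U"
  proof (rule Engel_common_annihilator[OF U K])
    show "subspace (?K \<inter> U)"
      by (intro subspace_inter K subalgebra_subspace U(1))
    show "?K \<inter> U \<subset> ?K"
      using False by blast
    show "u \<cdot> v \<in> ?K" if "u \<in> U" "v \<in> ?K" for u v
      using that by (rule KV)
    show "u \<cdot> v \<in> ?K \<inter> U" if "u \<in> U" "v \<in> ?K \<inter> U" for u v
      using that KV subalgebra_mult[OF U(1)] by blast
    show "?K \<subseteq> Engel u" if "u \<in> U" for u
      using V(3)[OF that] by blast
  qed
  then obtain x where x: "x \<in> left_kernel" "x \<notin> U" "\<And>u. u \<in> U \<Longrightarrow> u \<cdot> x \<in> U"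
    by blast
  have "x \<in> normaliser U"
    using x(1,3) by (simp add: normaliser_def left_kernelD subspace_0 subalgebra_subspace U(1))
  with x(2) show ?thesis by blast
qed

lemma Cartan_imp_minimal_Engel:
  assumes F: "infinite (UNIV :: 'f set) \<or> card (UNIV :: 'f set) \<ge> dim UNIV + 1"
    and "Cartan_subalgebra U"
  shows "minimal_in U {Engel a |a. True}"
proof -
  have U: "subalgebra U" "nilpotent U" "normaliser U = U"
    using assms(2) by (auto simp: Cartan_subalgebra_def)
  note UE = nilpotent_subset_Engel[OF U(2)] and sub = subalgebra_subspace[OF U(1)]
  \<comment> \<open>Least dimension over \<open>U\<close> makes \<open>Engel z\<close> minimal among
    the Engel subalgebras of elements of \<open>U\<close>.\<close>
  obtain z where z: "z \<in> U" "\<And>u. u \<in> U \<Longrightarrow> dim (Engel z) \<le> dim (Engel u)"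
    using ex_has_least_nat[of "\<lambda>u. u \<in> U" 0 "\<lambda>u. dim (Engel u)"] subspace_0[OF sub] by blast
  have min: "Engel w = Engel z" if "w \<in> U" "Engel w \<subseteq> Engel z" for w
    using that z(2) by (intro subspace_dim_equal subspace_Engel)
  have least: "Engel z \<subseteq> Engel u" if "u \<in> U" for u
    by (rule minimal_Engel_subset[OF F sub UE[OF z(1)] z(1) that min])
  have eq: "U = Engel z"
    using normaliser_grows[OF U(1) UE subalgebra_Engel _ least] U(3) UE[OF z(1)] by blast
  \<comment> \<open>For minimality among all Engel subalgebras, one inside \<open>U\<close> is
    rewritten as \<open>Engel b\<close> with \<open>b\<close> in \<open>U\<close>.\<close>
  have "Engel a = U" if "Engel a \<subseteq> U" for a
  proof -
    obtain b where "b \<in> Engel a" "Engel b = Engel a"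
      by (rule Engel_representative)
    then show ?thesis
      using that least[of b] eq by blast
  qed
  then show ?thesis
    using eq by (auto simp: minimal_in_def)
qed

end

theorem theorem4p5:
  fixes scale :: "'f::field \<Rightarrow> 'a::ab_group_add \<Rightarrow> 'a"
    and mult :: "'a \<Rightarrow> 'a \<Rightarrow> 'a"
    and n :: nat
    and U :: "'a set"
  assumes "leibniz_algebra scale mult"
    and "\<exists>Basis. finite_dimensional_vector_space scale Basis"
    and "vector_space.dim scale (UNIV :: 'a set) = n"
    and "infinite (UNIV :: 'f set) \<or> card (UNIV :: 'f set) \<ge> n + 1"
    and "leibniz_algebra.subalgebra scale mult U"
  shows "leibniz_algebra.Cartan_subalgebra scale mult U \<longleftrightarrow>
    minimal_in U {leibniz_algebra.Engel mult a |a. True}"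
proof -
  obtain Basis where "finite_dimensional_vector_space scale Basis"
    using assms(2) by blast
  then interpret fin_dim_leibniz_algebra scale mult Basis
    using assms(1) by (simp add: fin_dim_leibniz_algebra_def)
  have "infinite (UNIV :: 'f set) \<or> card (UNIV :: 'f set) \<ge> dim (UNIV :: 'a set) + 1"
    using assms(3,4) by simp
  then show ?thesis
    using Cartan_imp_minimal_Engel minimal_Engel_imp_Cartan by blast
qed

end
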